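(* Let $\Omega\subset\mathbb{R}^d$ be open, bounded and convex, let $n\ge1$, let $\{\phi_i\}_{i=1}^n\subset C^2(\overline{\Omega})$, let $\{g_\varepsilon\}_{\varepsilon>0}$ be an admissible smoothing family, and let $\varepsilon>0$. Set $\Phi_n=(\phi_1,\ldots,\phi_n)$, $v_n=\psi_n\circ\Phi_n$ and $v_{n,\varepsilon}=\psi_{n,\varepsilon}\circ\Phi_n$. Then $v_{n,\varepsilon}$ is $C$-semiconcave and $L$-Lipschitz continuous, with $$C=\max_{i\in\{1,\ldots,n\}}\|\nabla^2\phi_i\|_{C(\overline{\Omega};\mathbb{R}^{d\times d})}\quad\text{and}\quad L=\max_{i\in\{1,\ldots,n\}}\|\nabla\phi_i\|_{C(\overline{\Omega};\mathbb{R}^d)}.$$ Further, $$\|v_{n,\varepsilon}-v_n\|_{C(\overline{\Omega})}\le(n-1)\varepsilon,$$ and $v_{n,\varepsilon}$ is of class $C^{1,1}$ with $$\|\nabla^2v_{n,\varepsilon}\|_{L^\infty(\Omega;\mathbb{R}^{d\times d})}\le C+2n(n-1)L^2\|g_\varepsilon''\|_{L^\infty(\mathbb{R})}.$$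
   Context: A function $v\in C(\overline{\Omega})$ is $C$-semiconcave ($C\ge0$) if $x\mapsto v(x)-\frac{C}{2}|x|^2$ is concave on $\Omega$. $(x)_+=\max\{x,0\}$. A family $\{g_\varepsilon\}_{\varepsilon>0}\subset C^{1,1}(\mathbb{R})$ ($C^1$ functions with Lipschitz derivative) is called an admissible smoothing family if for every $\varepsilon>0$: $g_\varepsilon(x)\ge 0$ and $g_\varepsilon'(x)\in[0,1]$ for all $x\in\mathbb{R}$; $g_\varepsilon''(x)\ge 0$ for almost all $x\in\mathbb{R}$; $\sup_{x\in\mathbb{R}}|(x)_+-g_\varepsilon(x)|\le\varepsilon$; $g_\varepsilon''\in L^\infty(\mathbb{R})$; and, moreover, $g_\varepsilon'\to\chi_{[0,\infty)}$ uniformly on compact subsets of $\mathbb{R}\setminus\{0\}$ as $\varepsilon\to0^+$. For $a\in\mathbb{R}^n$, $\psi_n(a)=\min_{i\in\{1,\ldots,n\}}a_i$. The smoothed minimum is defined recursively by $\psi_{1,\varepsilon}(a)=a_1$ and $\psi_{i+1,\varepsilon}(a)=a_{i+1}-g_\varepsilon(a_{i+1}-\psi_{i,\varepsilon}(a))$ for $i\in\{1,\ldots,n-1\}$. Vectors carry the Euclidean norm and matrices the operator norm. *)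

theory Defs
  imports "HOL-Analysis.Analysis" "HOL-Probability.Essential_Supremum"
begin

section \<open>Gradient, Hessian and their norms\<close>

text \<open>At points where the derivative does not exist, the values of the total functions
  \<open>grad f\<close> and \<open>hess f\<close> are meaningless; differentiability is always asserted separately.\<close>

definition grad :: "('a::real_inner \<Rightarrow> real) \<Rightarrow> 'a \<Rightarrow> 'a" where
  "grad f x = (SOME D. GDERIV f x :> D)"

lemma grad_real: "grad (f :: real \<Rightarrow> real) = deriv f"
  by (rule ext) (simp add: grad_def deriv_def)

definition hess :: "(real^'d \<Rightarrow> real) \<Rightarrow> real^'d \<Rightarrow> real^'d^'d" where
  "hess f x = jacobian (grad f) (at x)"

text \<open>The norm of the type \<^typ>\<open>real^'d^'d\<close> is the Frobenius norm, so the operator norm has to be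
  written explicitly.\<close>

definition opnorm :: "real^'d^'d \<Rightarrow> real" where
  "opnorm A = onorm (\<lambda>h. A *v h)"

text \<open>\<open>sup_norm S (\<lambda>x. \<bar>F x\<bar>)\<close> is the supremum norm of \<open>F\<close> on \<open>S\<close>, for whichever pointwise norm is
  wanted. Inserting \<open>0\<close> changes nothing unless \<open>S\<close> is empty, where the norm is then \<open>0\<close>.\<close>

definition sup_norm :: "'a set \<Rightarrow> ('a \<Rightarrow> real) \<Rightarrow> real" where
  "sup_norm S h = Sup (insert 0 (h ` S))"

text \<open>Likewise \<open>Linf_norm S (\<lambda>x. \<bar>F x\<bar>)\<close> is the \<open>L\<^sup>\<infinity>(S)\<close>-norm of \<open>F\<close>; it is \<open>\<infinity>\<close> if \<open>F\<close> is not
  essentially bounded.\<close>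

definition Linf_norm :: "'a::euclidean_space set \<Rightarrow> ('a \<Rightarrow> real) \<Rightarrow> ereal" where
  "Linf_norm S h = esssup (lebesgue_on S) (\<lambda>x. ereal (h x))"


section \<open>Regularity classes\<close>

text \<open>The extension of \<open>F\<close> from \<open>\<Omega>\<close> to its closure by continuity (unique on the closure).\<close>

definition is_cont_ext :: "'a::topological_space set \<Rightarrow> ('a \<Rightarrow> 'b::topological_space) \<Rightarrow> ('a \<Rightarrow> 'b) \<Rightarrow> bool"
  where "is_cont_ext \<Omega> F G \<longleftrightarrow> continuous_on (closure \<Omega>) G \<and> (\<forall>x\<in>\<Omega>. G x = F x)"

definition cont_ext :: "'a::topological_space set \<Rightarrow> ('a \<Rightarrow> 'b::topological_space) \<Rightarrow> 'a \<Rightarrow> 'b" where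
  "cont_ext \<Omega> F = (SOME G. is_cont_ext \<Omega> F G)"

text \<open>\<open>C\<^sup>2\<close> up to the boundary: the function and its first and second derivatives in the open set
  \<open>\<Omega>\<close> extend continuously to the closure.\<close>

definition C2_closure :: "(real^'d) set \<Rightarrow> (real^'d \<Rightarrow> real) \<Rightarrow> bool" where
  "C2_closure \<Omega> f \<longleftrightarrow>
     continuous_on (closure \<Omega>) f \<and>
     (\<forall>x\<in>\<Omega>. f differentiable (at x) \<and> grad f differentiable (at x)) \<and>
     (\<exists>G. is_cont_ext \<Omega> (grad f) G) \<and>
     (\<exists>H. is_cont_ext \<Omega> (hess f) H)"

definition C11_on :: "'a::real_inner set \<Rightarrow> ('a \<Rightarrow> real) \<Rightarrow> bool" where
  "C11_on \<Omega> f \<longleftrightarrow> (\<forall>x\<in>\<Omega>. f differentiable (at x)) \<and> (\<exists>K. K-lipschitz_on \<Omega> (grad f))"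

definition semiconcave :: "'a::euclidean_space set \<Rightarrow> real \<Rightarrow> ('a \<Rightarrow> real) \<Rightarrow> bool" where
  "semiconcave \<Omega> C v \<longleftrightarrow> 0 \<le> C \<and> continuous_on (closure \<Omega>) v \<and>
     concave_on \<Omega> (\<lambda>x. v x - C / 2 * (norm x)\<^sup>2)"


section \<open>Smoothed minimum\<close>

text \<open>The second derivative of the \<open>C\<^sup>1\<^sup>,\<^sup>1\<close> function \<open>g \<epsilon>\<close> is the derivative of \<open>deriv (g \<epsilon>)\<close>, which
  exists almost everywhere because \<open>deriv (g \<epsilon>)\<close> is Lipschitz.\<close>

definition admissible_smoothing_family :: "(real \<Rightarrow> real \<Rightarrow> real) \<Rightarrow> bool" where
  "admissible_smoothing_family g \<longleftrightarrow>
     (\<forall>\<epsilon>>0.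
        C11_on UNIV (g \<epsilon>) \<and>
        (\<forall>x. 0 \<le> g \<epsilon> x \<and> deriv (g \<epsilon>) x \<in> {0..1}) \<and>
        (AE x in lebesgue. deriv (g \<epsilon>) differentiable (at x) \<and> 0 \<le> deriv (deriv (g \<epsilon>)) x) \<and>
        (\<forall>x. \<bar>max x 0 - g \<epsilon> x\<bar> \<le> \<epsilon>) \<and>
        Linf_norm UNIV (\<lambda>x. \<bar>deriv (deriv (g \<epsilon>)) x\<bar>) < \<infinity>) \<and>
     (\<forall>K. compact K \<and> K \<subseteq> UNIV - {0} \<longrightarrow>
        uniform_limit K (\<lambda>\<epsilon>. deriv (g \<epsilon>)) (indicator {0..}) (at_right 0))"

text \<open>A vector \<open>a \<in> \<real>\<^sup>n\<close> is a function on \<open>nat\<close> of which only the values at \<open>1, \<dots>, n\<close> are used.\<close>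

definition psi :: "nat \<Rightarrow> (nat \<Rightarrow> real) \<Rightarrow> real" where
  "psi n a = Min (a ` {1..n})"

text \<open>The first argument \<open>h\<close> stands for \<open>g \<epsilon>\<close>; the value for \<open>n = 0\<close> is a dummy.\<close>

fun psi_smooth :: "(real \<Rightarrow> real) \<Rightarrow> nat \<Rightarrow> (nat \<Rightarrow> real) \<Rightarrow> real" where
  "psi_smooth h 0 a = 0"
| "psi_smooth h (Suc 0) a = a 1"
| "psi_smooth h (Suc (Suc i)) a =
     a (Suc (Suc i)) - h (a (Suc (Suc i)) - psi_smooth h (Suc i) a)"

end

theory Submission
  imports Defs
begin

text \<open>The map \<open>psi_smooth h n\<close> is monotone, concave and commutes with adding a constant to all arguments,
  which yields the Lipschitz and semiconcavity claims without second derivatives of \<open>v\<^sub>\<epsilon>\<close>; concavity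
  rests on the convexity of \<open>h\<close>, whose derivative is Lipschitz and has a.e. nonnegative derivative.
  For the Hessian, put \<open>w = p - q\<close>, so that \<open>p - h \<circ> w\<close> has gradient \<open>\<nabla>p - h'(w) \<nabla>w\<close>. Where
  \<open>\<nabla>w \<noteq> 0\<close>, the preimage under \<open>w\<close> of the null set on which \<open>h'\<close> is not differentiable is null.
  Where \<open>\<nabla>w = 0\<close>, Lipschitz continuity of \<open>h'\<close> suffices. Each step adds at most
  \<open>\<bar>h''\<bar> \<bar>\<nabla>w\<bar>\<^sup>2 \<le> 4 L\<^sup>2 M\<close> to the Hessian bound, and \<open>4 (n - 1) \<le> 2 n (n - 1)\<close> for \<open>n \<ge> 2\<close>.\<close>

section \<open>Gradients as representatives of derivatives\<close>

lemma differentiable_imp_GDERIV_grad: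
  fixes f :: "'a::euclidean_space \<Rightarrow> real"
  assumes "f differentiable (at x)"
  shows "GDERIV f x :> grad f x"
proof -
  obtain D where D: "(f has_derivative D) (at x)"
    using assms by (auto simp: differentiable_def)
  \<comment> \<open>The Riesz representative of the functional \<open>D\<close> is its adjoint
    evaluated at \<open>1\<close>.\<close>
  have "D = (\<lambda>h. h \<bullet> adjoint D 1)"
    using adjoint_works[OF has_derivative_linear[OF D], of _ 1] by auto
  then have "GDERIV f x :> adjoint D 1"
    using D unfolding gderiv_def by presburger
  then show ?thesis
    unfolding grad_def by (rule someI)
qed

lemma GDERIV_imp_grad:
  fixes f :: "'a::euclidean_space \<Rightarrow> real"
  assumes "GDERIV f x :> D"
  shows "grad f x = D"
proof -
  have "f differentiable (at x)"
    using assms by (auto simp: differentiable_def gderiv_def)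
  then have "(\<lambda>h. h \<bullet> grad f x) = (\<lambda>h. h \<bullet> D)"
    using assms has_derivative_unique
    by (blast dest: differentiable_imp_GDERIV_grad[unfolded gderiv_def] intro: assms[unfolded gderiv_def])
  then show ?thesis
    by (metis inner_commute vector_eq_ldot)
qed

section \<open>Almost everywhere monotonicity and preimages of null sets\<close>

text \<open>If \<open>f\<close> descended somewhere, adding a small slope would keep the descent
  while making the derivative strictly positive outside \<open>E\<close>. At the last crossing of a
  level that avoids the image of \<open>E\<close>, the function would then have to rise above that
  level again.\<close>

lemma ae_deriv_nonneg_imp_mono:
  fixes f :: "real \<Rightarrow> real"
  assumes lip: "K-lipschitz_on UNIV f" and E: "negligible E"
    and der: "\<And>x. x \<notin> E \<Longrightarrow> (f has_real_derivative f' x) (at x)"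
    and nonneg: "\<And>x. x \<notin> E \<Longrightarrow> 0 \<le> f' x"
  shows "mono f"
proof (rule monoI, rule ccontr)
  fix a b :: real assume ab: "a \<le> b" and "\<not> f a \<le> f b"
  then have less: "f b < f a" and "a < b" by (auto simp: less_le)
  \<comment> \<open>Half of the mean rate of descent of \<open>f\<close>, so that \<open>F\<close>
    still descends by half as much.\<close>
  define \<delta> where "\<delta> = (f a - f b) / 2 / (b - a)"
  define F where "F x = f x + \<delta> * x" for x
  have "\<delta> > 0" using less \<open>a < b\<close> by (simp add: \<delta>_def)
  have "F a - F b = (f a - f b) / 2"
  proof -
    have "\<delta> * (b - a) = (f a - f b) / 2" using \<open>a < b\<close> unfolding \<delta>_def
      by (metis eq_iff_diff_eq_0 less_irrefl nonzero_eq_divide_eq)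
    then show ?thesis by (simp add: F_def algebra_simps)
  qed
  then have Fless: "F b < F a" using less by simp
  have F_lip: "(K + \<delta>)-lipschitz_on UNIV F"
    unfolding F_def using lip \<open>\<delta> > 0\<close>
    by (intro lipschitz_on_add lip) (auto intro!: lipschitz_onI simp: dist_real_def abs_mult simp flip: right_diff_distrib)
  then have cont: "continuous_on S F" for S
    by (meson continuous_on_subset lipschitz_on_continuous_on subset_UNIV)
  \<comment> \<open>Lipschitz images of null sets are null, so the interval between
    \<open>F b\<close> and \<open>F a\<close> contains a level taken only at points outside
    \<open>E\<close>.\<close>
  have "negligible (F ` E)"
  proof (rule negligible_locally_Lipschitz_image)
    show "\<exists>T B. open T \<and> x \<in> T \<and> (\<forall>y\<in>E \<inter> T. norm (F y - F x) \<le> B * norm (y - x))" for x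
      using lipschitz_on_normD[OF F_lip] by (intro exI[of _ UNIV] exI[of _ "K + \<delta>"]) auto
  qed (use E in auto)
  moreover have "\<not> negligible {F b<..<F a}"
    using Fless negligible_interval(2)[of "F b" "F a"] by (simp add: box_real)
  ultimately obtain y where y: "F b < y" "y < F a" "y \<notin> F ` E"
    by (meson greaterThanLessThan_iff negligible_subset subsetI)
  \<comment> \<open>The largest element \<open>s\<close> of this compact set is the last crossing:
    by the intermediate value theorem \<open>F s = y\<close>, hence \<open>s\<close> is not in
    \<open>E\<close> and \<open>F\<close> has a positive derivative there.\<close>
  define S where "S = {x \<in> {a..b}. y \<le> F x}"
  have "compact S"
    unfolding S_def using continuous_closed_preimage[OF cont, of "{a..b}" "{y..}"]
    by (auto simp: compact_eq_bounded_closed vimage_def Int_def intro: bounded_subset[of "{a..b}"])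
  moreover have "a \<in> S" using y ab by (simp add: S_def)
  ultimately obtain s where s: "s \<in> S" "\<And>t. t \<in> S \<Longrightarrow> t \<le> s"
    using compact_attains_sup[of S] by blast
  then have sb: "a \<le> s" "s \<le> b" "y \<le> F s" by (auto simp: S_def)
  then obtain t where "s \<le> t" "t \<le> b" "F t = y"
    using IVT2'[of F b y s] y cont by auto
  then have "t \<in> S" using sb by (simp add: S_def)
  with s(2) \<open>s \<le> t\<close> \<open>F t = y\<close> have "F s = y" by (metis order_antisym)
  then have "s \<notin> E" "s < b" using y sb by (auto simp: less_le)
  then have "(F has_real_derivative (f' s + \<delta>)) (at s)"
    unfolding F_def by (auto intro!: derivative_eq_intros der)
  then obtain d where d: "d > 0" "\<And>h. 0 < h \<Longrightarrow> h < d \<Longrightarrow> F s < F (s + h)"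
    using DERIV_pos_inc_right[of F "f' s + \<delta>" s] nonneg[OF \<open>s \<notin> E\<close>] \<open>\<delta> > 0\<close> by auto
  define h where "h = min (d / 2) (b - s)"
  have "0 < h" "h < d" "s + h \<le> b" using d \<open>s < b\<close> by (auto simp: h_def)
  then have "s + h \<in> S" using d(2)[of h] \<open>F s = y\<close> sb by (simp add: S_def)
  with s(2) \<open>0 < h\<close> show False by fastforce
qed

text \<open>The preimage is a cylinder. In the product formula for Lebesgue measure the factor in
  direction \<open>b\<close> is zero, and zero times infinity is zero in
  \<open>ennreal\<close>.\<close>

lemma negligible_inner_Basis_vimage:
  fixes b :: "'a::euclidean_space"
  assumes N: "negligible (N :: real set)" and b: "b \<in> Basis"
  shows "negligible {z. z \<bullet> b \<in> N}"
proof -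
  \<comment> \<open>A null set need not be Borel; enlarging it to a Borel null set makes the
    cylinder measurable for the product measure.\<close>
  obtain N' where N': "N' \<in> null_sets lborel" "N \<subseteq> N'"
    using N null_sets_completion_iff2[of N lborel] by (auto simp: negligible_iff_null_sets)
  then have [measurable]: "N' \<in> sets borel" by auto
  have meas: "{z::'a. z \<bullet> b \<in> N'} \<in> sets borel" by measurable
  interpret product_sigma_finite "\<lambda>_::'a. lborel :: real measure" ..
  let ?s = "\<lambda>f. \<Sum>c\<in>Basis. f c *\<^sub>R (c::'a)"
  have "emeasure lborel {z::'a. z \<bullet> b \<in> N'}
      = emeasure (\<Pi>\<^sub>M c\<in>Basis. lborel) (?s -` {z::'a. z \<bullet> b \<in> N'} \<inter> space (\<Pi>\<^sub>M c\<in>Basis. lborel))"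
    by (subst lborel_eq, rule emeasure_distr) (use meas in auto)
  also have "?s -` {z. z \<bullet> b \<in> N'} \<inter> space (\<Pi>\<^sub>M c\<in>Basis. lborel)
      = Pi\<^sub>E Basis (\<lambda>c. if c = b then N' else UNIV)"
    using b by (auto simp: space_PiM PiE_iff split: if_splits)
  also have "emeasure (\<Pi>\<^sub>M c\<in>Basis. lborel) \<dots>
      = (\<Prod>c\<in>Basis. emeasure lborel (if c = b then N' else UNIV))"
    by (rule emeasure_PiM) auto
  also have "\<dots> = 0"
    using b N' by (intro prod_zero) (auto intro!: bexI[of _ b])
  finally have "{z::'a. z \<bullet> b \<in> N'} \<in> null_sets lborel"
    using meas by (auto simp: null_sets_def)
  then have "negligible {z::'a. z \<bullet> b \<in> N'}"
    by (simp add: negligible_iff_null_sets null_sets_completionI)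
  then show ?thesis
    by (rule negligible_subset) (use N' in auto)
qed

text \<open>Near a point where the derivative of \<open>w\<close> in a coordinate direction \<open>b\<close> is nonzero,
  \<open>w\<close> can replace the coordinate \<open>x \<bullet> b\<close>.\<close>

lemma negligible_vimage_grad_nonzero:
  fixes w :: "'a::euclidean_space \<Rightarrow> real"
  assumes N: "negligible N" and der: "\<And>x. x \<in> S \<Longrightarrow> GDERIV w x :> W x"
  shows "negligible {x \<in> S. W x \<noteq> 0 \<and> w x \<in> N}"
proof -
  define T where "T b = {x \<in> {x \<in> S. W x \<bullet> b \<noteq> 0}. x + (w x - x \<bullet> b) *\<^sub>R b \<in> {z. z \<bullet> b \<in> N}}" for b
  have "negligible (T b)" if b: "b \<in> Basis" for b :: 'a
    unfolding T_def
  proof (rule negligible_differentiable_vimage[where f' = "\<lambda>x h. h + (h \<bullet> W x - h \<bullet> b) *\<^sub>R b"])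
    show "negligible {z. z \<bullet> b \<in> N}" by (rule negligible_inner_Basis_vimage[OF N b])
  next
    fix x assume x: "x \<in> {x \<in> S. W x \<bullet> b \<noteq> 0}"
    \<comment> \<open>The derivative keeps the components orthogonal to \<open>b\<close> and turns
      the component along \<open>b\<close> into \<open>h \<bullet> W x\<close>. A kernel element is
      therefore a multiple of \<open>b\<close> orthogonal to \<open>W x\<close>, and
      \<open>W x \<bullet> b \<noteq> 0\<close> makes it zero.\<close>
    show "inj (\<lambda>h. h + (h \<bullet> W x - h \<bullet> b) *\<^sub>R b)"
    proof (rule linear_injective_0[THEN iffD2, rule_format])
      show "linear (\<lambda>h. h + (h \<bullet> W x - h \<bullet> b) *\<^sub>R b)"
        by (rule linearI) (auto simp: algebra_simps)
    next
      fix h assume h: "h + (h \<bullet> W x - h \<bullet> b) *\<^sub>R b = 0"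
      from arg_cong[OF this, of "\<lambda>z. z \<bullet> b"] have "h \<bullet> W x = 0"
        using b by (simp add: algebra_simps)
      with h have "h = (h \<bullet> b) *\<^sub>R b" by simp
      then have "h \<bullet> W x = (h \<bullet> b) * (W x \<bullet> b)"
        by (metis inner_commute inner_scaleR_left)
      with \<open>h \<bullet> W x = 0\<close> x have "h \<bullet> b = 0" by simp
      with \<open>h = (h \<bullet> b) *\<^sub>R b\<close> show "h = 0" by simp
    qed
    have "(w has_derivative (\<lambda>h. h \<bullet> W x)) (at x)"
      using der x by (simp add: gderiv_def)
    then show "((\<lambda>x. x + (w x - x \<bullet> b) *\<^sub>R b) has_derivative (\<lambda>h. h + (h \<bullet> W x - h \<bullet> b) *\<^sub>R b))
        (at x within {x \<in> S. W x \<bullet> b \<noteq> 0})"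
      by (auto intro!: derivative_eq_intros intro: has_derivative_at_withinI)
  qed
  then have "negligible (\<Union>b\<in>Basis. T b)"
    by (intro negligible_Union) auto
  moreover have "{x \<in> S. W x \<noteq> 0 \<and> w x \<in> N} \<subseteq> (\<Union>b\<in>Basis. T b)"
  proof clarify
    fix x assume x: "x \<in> S" "w x \<in> N" "W x \<noteq> 0"
    then obtain b where b: "b \<in> Basis" "W x \<bullet> b \<noteq> 0" by (metis euclidean_all_zero_iff)
    then have "x \<in> T b" using x by (simp add: T_def algebra_simps)
    with b show "x \<in> (\<Union>b\<in>Basis. T b)" by blast
  qed
  ultimately show ?thesis by (rule negligible_subset)
qed

section \<open>Order, concavity and error estimates for the smoothed minimum\<close>

lemma psi_smooth_Suc:
  "1 \<le> n \<Longrightarrow> psi_smooth h (Suc n) a = a (Suc n) - h (a (Suc n) - psi_smooth h n a)"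
  by (cases n) auto

lemma psi_Suc: "1 \<le> n \<Longrightarrow> psi (Suc n) a = min (a (Suc n)) (psi n a)"
  by (simp add: psi_def atLeastAtMostSuc_conv Min_insert)

text \<open>In one step, \<open>x - h (x - p)\<close> is nondecreasing in \<open>x\<close> because
  \<open>h\<close> has slope at most 1, and in \<open>p\<close> because \<open>h\<close> is
  nondecreasing. The induction moves the two arguments in turn.\<close>

lemma psi_smooth_mono:
  assumes h: "\<And>x y. x \<le> y \<Longrightarrow> h x \<le> h y \<and> h y - h x \<le> y - x"
    and "1 \<le> n" and "\<And>i. i \<in> {1..n} \<Longrightarrow> a i \<le> b i"
  shows "psi_smooth h n a \<le> psi_smooth h n b"
  using assms(2,3)
proof (induction n rule: nat_induct_at_least)
  case (Suc n)
  then have le: "a (Suc n) \<le> b (Suc n)" "psi_smooth h n a \<le> psi_smooth h n b"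
    by auto
  have "h (b (Suc n) - psi_smooth h n b) \<le> h (b (Suc n) - psi_smooth h n a)"
    "h (b (Suc n) - psi_smooth h n a) - h (a (Suc n) - psi_smooth h n a) \<le> b (Suc n) - a (Suc n)"
    using le h[of "b (Suc n) - psi_smooth h n b" "b (Suc n) - psi_smooth h n a"]
      h[of "a (Suc n) - psi_smooth h n a" "b (Suc n) - psi_smooth h n a"] by auto
  then show ?case using Suc.hyps by (simp add: psi_smooth_Suc)
qed simp

lemma psi_smooth_translation:
  "1 \<le> n \<Longrightarrow> psi_smooth h n (\<lambda>i. a i + c) = psi_smooth h n a + c"
  by (induction n rule: nat_induct_at_least) (auto simp: psi_smooth_Suc)

text \<open>A monotone map that commutes with translations is nonexpansive in the maximum norm:
  shifting either vector up by \<open>c\<close> makes it dominate the other.\<close>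

lemma psi_smooth_nonexpansive:
  assumes h: "\<And>x y. x \<le> y \<Longrightarrow> h x \<le> h y \<and> h y - h x \<le> y - x"
    and n: "1 \<le> n" and ab: "\<And>i. i \<in> {1..n} \<Longrightarrow> \<bar>a i - b i\<bar> \<le> c"
  shows "\<bar>psi_smooth h n a - psi_smooth h n b\<bar> \<le> c"
proof -
  have "psi_smooth h n a \<le> psi_smooth h n (\<lambda>i. b i + c)"
    "psi_smooth h n b \<le> psi_smooth h n (\<lambda>i. a i + c)"
    using ab by (intro psi_smooth_mono[OF h n]; force simp: abs_le_iff)+
  then show ?thesis using n by (simp add: psi_smooth_translation)
qed

text \<open>By induction the new argument of \<open>h\<close> lies below the convex combination of
  the two old ones; since \<open>h\<close> is nondecreasing and convex, the subtracted term is
  convex.\<close>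

lemma psi_smooth_concave:
  assumes h: "mono h" "convex_on UNIV h" and uv: "0 \<le> u" "0 \<le> v" "u + v = 1"
    and "1 \<le> n"
  shows "u * psi_smooth h n a + v * psi_smooth h n b \<le> psi_smooth h n (\<lambda>i. u * a i + v * b i)"
  using \<open>1 \<le> n\<close>
proof (induction n rule: nat_induct_at_least)
  case (Suc n)
  let ?p = "a (Suc n) - psi_smooth h n a" and ?q = "b (Suc n) - psi_smooth h n b"
  have "h (u * a (Suc n) + v * b (Suc n) - psi_smooth h n (\<lambda>i. u * a i + v * b i)) \<le> h (u * ?p + v * ?q)"
    using Suc.IH by (intro monoD[OF h(1)]) (simp add: algebra_simps)
  also have "\<dots> \<le> u * h ?p + v * h ?q"
    using h(2) uv by (simp add: convex_on_def)
  finally show ?case using Suc.hyps by (simp add: psi_smooth_Suc algebra_simps)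
qed simp

text \<open>Commuting with translations lets the common correction \<open>c x\<close> be subtracted
  inside every argument. Semiconcavity then becomes plain concavity, which passes through a monotone
  concave map.\<close>

lemma concave_on_psi_smooth:
  assumes h: "\<And>x y. x \<le> y \<Longrightarrow> h x \<le> h y \<and> h y - h x \<le> y - x" "convex_on UNIV h"
    and n: "1 \<le> n" and f: "\<And>i. i \<in> {1..n} \<Longrightarrow> concave_on S (\<lambda>x. f i x - c x)"
  shows "concave_on S (\<lambda>x. psi_smooth h n (\<lambda>i. f i x) - c x)"
  unfolding concave_on_iff
proof (intro conjI ballI allI impI)
  show "convex S" using f[of 1] n by (auto simp: concave_on_iff)
next
  fix x y u v assume xy: "x \<in> S" "y \<in> S" and uv: "0 \<le> u" "0 \<le> v" "u + v = (1 :: real)"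
  let ?z = "u *\<^sub>R x + v *\<^sub>R y"
  let ?g = "\<lambda>x i. f i x - c x"
  have psi_eq: "psi_smooth h n (\<lambda>i. f i x) - c x = psi_smooth h n (?g x)" for x
    using psi_smooth_translation[OF n, of h "\<lambda>i. f i x" "- c x"] by simp
  have "u * psi_smooth h n (?g x) + v * psi_smooth h n (?g y) \<le> psi_smooth h n (\<lambda>i. u * ?g x i + v * ?g y i)"
    using h by (intro psi_smooth_concave uv n) (auto intro: monoI)
  also have "\<dots> \<le> psi_smooth h n (?g ?z)"
    using f xy uv by (intro psi_smooth_mono[OF h(1) n]) (auto simp: concave_on_iff)
  finally show "u * (psi_smooth h n (\<lambda>i. f i x) - c x) + v * (psi_smooth h n (\<lambda>i. f i y) - c y)
      \<le> psi_smooth h n (\<lambda>i. f i ?z) - c ?z"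
    by (simp add: psi_eq)
qed

text \<open>Replacing \<open>max (x - p) 0\<close> by \<open>h (x - p)\<close> costs at most
  \<open>\<epsilon>\<close> per step, and the exact minimum is nonexpansive in its second argument,
  so earlier errors are not amplified. There are \<open>n - 1\<close> steps.\<close>

lemma psi_smooth_error:
  assumes h: "\<And>x. \<bar>max x 0 - h x\<bar> \<le> \<epsilon>" and "1 \<le> n"
  shows "\<bar>psi_smooth h n a - psi n a\<bar> \<le> (real n - 1) * \<epsilon>"
  using \<open>1 \<le> n\<close>
proof (induction n rule: nat_induct_at_least)
  case (Suc n)
  let ?x = "a (Suc n)" and ?p = "psi_smooth h n a"
  have "\<bar>min ?x ?p - min ?x (psi n a)\<bar> \<le> (real n - 1) * \<epsilon>"
    using Suc.IH by (auto simp: min_def split: if_splits)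
  moreover have "min ?x ?p = ?x - max (?x - ?p) 0" by auto
  ultimately have "\<bar>?x - h (?x - ?p) - min ?x (psi n a)\<bar> \<le> \<epsilon> + (real n - 1) * \<epsilon>"
    using h[of "?x - ?p"] by linarith
  then show ?case using Suc.hyps by (simp add: psi_smooth_Suc psi_Suc algebra_simps)
qed (simp add: psi_def)

lemma lipschitz_on_psi_smooth:
  assumes h: "\<And>x y. x \<le> y \<Longrightarrow> h x \<le> h y \<and> h y - h x \<le> y - x"
    and n: "1 \<le> n" and f: "\<And>i. i \<in> {1..n} \<Longrightarrow> L-lipschitz_on S (f i)"
  shows "L-lipschitz_on S (\<lambda>x. psi_smooth h n (\<lambda>i. f i x))"
proof (rule lipschitz_onI)
  fix x y assume "x \<in> S" "y \<in> S"
  then show "dist (psi_smooth h n (\<lambda>i. f i x)) (psi_smooth h n (\<lambda>i. f i y)) \<le> L * dist x y"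
    using lipschitz_onD[OF f] unfolding dist_real_def by (intro psi_smooth_nonexpansive[OF h n]) auto
qed (use f[of 1] n lipschitz_on_nonneg in auto)

section \<open>Semiconcavity from a Lipschitz gradient\<close>

text \<open>Along a segment the negated function has a nondecreasing derivative: by Cauchy-Schwarz
  and the Lipschitz bound on \<open>F\<close>, the growth of the quadratic term dominates the
  variation of the gradient.\<close>

lemma lipschitz_grad_imp_concave_on:
  fixes f :: "'a::euclidean_space \<Rightarrow> real"
  assumes S: "convex S" and der: "\<And>x. x \<in> S \<Longrightarrow> GDERIV f x :> F x"
    and lip: "C-lipschitz_on S F"
  shows "concave_on S (\<lambda>x. f x - C / 2 * (norm x)\<^sup>2)"
  unfolding concave_on_def
proof (rule convex_onI)
  fix t :: real and x y assume t: "0 < t" "t < 1" and xy: "x \<in> S" "y \<in> S"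
  define p where "p s = x + s *\<^sub>R (y - x)" for s
  define k where "k s = - (f (p s) - C / 2 * (norm (p s))\<^sup>2)" for s
  define k' where "k' s = C * (p s \<bullet> (y - x)) - F (p s) \<bullet> (y - x)" for s
  have pS: "p s \<in> S" if "s \<in> {0..1}" for s
    using that S xy convexD_alt[of S x y s] by (auto simp: p_def algebra_simps)
  have "convex_on {0..1} k"
  proof (rule convex_on_realI)
    fix s :: real assume s: "s \<in> {0..1}"
    have p: "(p has_derivative (\<lambda>h. h *\<^sub>R (y - x))) (at s)"
      unfolding p_def by (auto intro!: derivative_eq_intros)
    have fp: "((\<lambda>s. f (p s)) has_derivative (\<lambda>h. (h *\<^sub>R (y - x)) \<bullet> F (p s))) (at s)"
      using has_derivative_compose[OF p der[OF pS[OF s], unfolded gderiv_def]] .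
    show "(k has_real_derivative k' s) (at s)"
      unfolding has_field_derivative_def k_def power2_norm_eq_inner
      by (rule has_derivative_eq_rhs, (rule derivative_intros p fp)+)
        (auto simp: fun_eq_iff k'_def algebra_simps inner_commute)
  next
    fix s t :: real assume st: "s \<in> {0..1}" "t \<in> {0..1}" "s \<le> t"
    have diff: "p t - p s = (t - s) *\<^sub>R (y - x)" by (simp add: p_def algebra_simps)
    have "(F (p t) - F (p s)) \<bullet> (y - x) \<le> norm (F (p t) - F (p s)) * norm (y - x)"
      by (rule norm_cauchy_schwarz)
    also have "\<dots> \<le> (C * norm (p t - p s)) * norm (y - x)"
      using lipschitz_on_normD[OF lip pS pS] st by (intro mult_right_mono) auto
    also have "\<dots> = C * ((p t - p s) \<bullet> (y - x))"
      using st by (simp add: diff power2_eq_square flip: power2_norm_eq_inner)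
    finally show "k' s \<le> k' t" by (simp add: k'_def algebra_simps)
  qed auto
  from convex_onD[OF this, of t 0 1] t have "k t \<le> (1 - t) * k 0 + t * k 1" by simp
  moreover have "p 0 = x" "p 1 = y" "p t = (1 - t) *\<^sub>R x + t *\<^sub>R y"
    by (auto simp: p_def algebra_simps)
  ultimately show "- (f ((1 - t) *\<^sub>R x + t *\<^sub>R y) - C / 2 * (norm ((1 - t) *\<^sub>R x + t *\<^sub>R y))\<^sup>2)
      \<le> (1 - t) * - (f x - C / 2 * (norm x)\<^sup>2) + t * - (f y - C / 2 * (norm y)\<^sup>2)"
    by (simp add: k_def)
qed (rule S)

section \<open>Second-order bounds for one smoothing step\<close>

text \<open>A quantitative form of \<open>C\<^sup>1\<^sup>,\<^sup>1\<close>. Almost everywhere differentiability of the gradient is part of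
  the induction hypothesis, so that Rademacher's theorem is not needed.\<close>

definition C11_bounded :: "'a::euclidean_space set \<Rightarrow> real \<Rightarrow> real \<Rightarrow> ('a \<Rightarrow> real) \<Rightarrow> bool" where
  "C11_bounded \<Omega> L B f \<longleftrightarrow>
     (\<forall>x\<in>\<Omega>. f differentiable (at x) \<and> norm (grad f x) \<le> L) \<and>
     (\<exists>K. K-lipschitz_on \<Omega> (grad f)) \<and>
     (\<exists>Z. negligible Z \<and> (\<forall>x\<in>\<Omega> - Z. \<exists>H. (grad f has_derivative H) (at x) \<and> onorm H \<le> B))"

text \<open>Serves for the product of \<open>h'(w)\<close> with the gradient of \<open>w\<close>.
  The estimate adds and subtracts \<open>s x *\<^sub>R W y\<close>.\<close>

lemma lipschitz_on_scaleR_bounded: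
  fixes W :: "'a::metric_space \<Rightarrow> 'b::real_normed_vector"
  assumes s: "A-lipschitz_on S s" "\<And>x. x \<in> S \<Longrightarrow> \<bar>s x\<bar> \<le> a"
    and W: "B-lipschitz_on S W" "\<And>x. x \<in> S \<Longrightarrow> norm (W x) \<le> b"
    and nonneg: "0 \<le> a" "0 \<le> b"
  shows "(a * B + A * b)-lipschitz_on S (\<lambda>x. s x *\<^sub>R W x)"
proof (rule lipschitz_onI)
  have AB: "0 \<le> A" "0 \<le> B" using s W by (auto dest: lipschitz_on_nonneg)
  then show "0 \<le> a * B + A * b" using nonneg by auto
  fix x y assume xy: "x \<in> S" "y \<in> S"
  have "norm (s x *\<^sub>R W x - s y *\<^sub>R W y) = norm (s x *\<^sub>R (W x - W y) + (s x - s y) *\<^sub>R W y)"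
    by (simp add: algebra_simps)
  also have "\<dots> \<le> \<bar>s x\<bar> * norm (W x - W y) + \<bar>s x - s y\<bar> * norm (W y)"
    by (metis norm_scaleR norm_triangle_ineq)
  also have "\<dots> \<le> a * (B * dist x y) + (A * dist x y) * b"
    using s(2)[of x] W(2)[of y] lipschitz_onD[OF s(1) xy] lipschitz_onD[OF W(1) xy] xy AB nonneg
    by (intro add_mono mult_mono) (auto simp: dist_norm)
  finally show "dist (s x *\<^sub>R W x) (s y *\<^sub>R W y) \<le> (a * B + A * b) * dist x y"
    by (simp add: dist_norm algebra_simps)
qed

text \<open>No differentiability of \<open>s\<close> is required: the term \<open>(s y - s x) *\<^sub>R W y\<close> is of second order.\<close>

lemma has_derivative_scaleR_at_zero:
  fixes W :: "'a::real_normed_vector \<Rightarrow> 'b::real_normed_vector"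
  assumes "open S" "x \<in> S"
    and s: "A-lipschitz_on S s" and W: "B-lipschitz_on S W" "W x = 0"
    and der: "(W has_derivative D) (at x)"
  shows "((\<lambda>y. s y *\<^sub>R W y) has_derivative (\<lambda>h. s x *\<^sub>R D h)) (at x)"
proof -
  obtain e where e: "e > 0" "ball x e \<subseteq> S"
    using assms(1,2) by (auto simp: open_contains_ball)
  have "((\<lambda>y. (s y - s x) *\<^sub>R W y) has_derivative (\<lambda>h. 0)) (at x)"
  proof (rule has_derivativeI_sandwich[where H = "\<lambda>y. A * B * norm (y - x)", OF e(1)])
    fix y assume y: "y \<noteq> x" "dist y x < e"
    with e have yS: "y \<in> S" by (auto simp: dist_commute)
    have "norm (W y) \<le> B * norm (y - x)"
      using lipschitz_on_normD[OF W(1) yS \<open>x \<in> S\<close>] W(2) by simp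
    moreover have "\<bar>s y - s x\<bar> \<le> A * norm (y - x)"
      using lipschitz_on_normD[OF s yS \<open>x \<in> S\<close>] by simp
    ultimately have "norm ((s y - s x) *\<^sub>R W y) \<le> (A * norm (y - x)) * (B * norm (y - x))"
      using lipschitz_on_nonneg[OF s] by (auto intro!: mult_mono)
    then show "norm ((s y - s x) *\<^sub>R W y - (s x - s x) *\<^sub>R W x - 0) / norm (y - x)
        \<le> A * B * norm (y - x)"
      using y by (simp add: divide_le_eq ac_simps)
  next
    have "((\<lambda>y. A * B * norm (y - x)) \<longlongrightarrow> A * B * norm (x - x)) (at x)"
      by (intro tendsto_intros)
    then show "((\<lambda>y. A * B * norm (y - x)) \<longlongrightarrow> 0) (at x)" by simp
  qed simp
  from has_derivative_add[OF this has_derivative_scaleR_right[OF der, of "s x"]]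
  show ?thesis by (simp add: algebra_simps)
qed

text \<open>The new gradient is a convex combination of those of \<open>p\<close> and
  \<open>q\<close>, so the bound \<open>L\<close> survives unchanged. Almost everywhere the new
  Hessian is the same convex combination of the old ones, of norm at most \<open>B\<close>, minus a
  rank-one term of norm at most \<open>M * (2 * L)\<^sup>2\<close>.\<close>

lemma C11_bounded_smoothed_min:
  fixes p q :: "'a::euclidean_space \<Rightarrow> real"
  assumes \<Omega>: "open \<Omega>" "convex \<Omega>"
    and p: "C11_bounded \<Omega> L C p" and q: "C11_bounded \<Omega> L B q" and "C \<le> B" "0 \<le> L"
    and h: "\<And>y. (h has_real_derivative h' y) (at y)" "\<And>y. h' y \<in> {0..1}" "K-lipschitz_on UNIV h'"
    and N: "negligible N" "\<And>y. y \<notin> N \<Longrightarrow> \<exists>d. (h' has_real_derivative d) (at y) \<and> \<bar>d\<bar> \<le> M" and "0 \<le> M"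
  shows "C11_bounded \<Omega> L (B + 4 * L\<^sup>2 * M) (\<lambda>x. p x - h (p x - q x))"
proof -
  define w where "w x = p x - q x" for x
  define P where "P = grad p"
  define Q where "Q = grad q"
  define W where "W x = P x - Q x" for x
  define s where "s x = h' (w x)" for x
  define r where "r x = p x - h (p x - q x)" for x
  define R where "R x = P x - s x *\<^sub>R W x" for x
  note [simp] = h(2)[simplified]
  have s01: "0 \<le> s x" "s x \<le> 1" for x by (auto simp: s_def)
  have derp: "GDERIV p x :> P x" and derq: "GDERIV q x :> Q x" and bd: "norm (P x) \<le> L" "norm (Q x) \<le> L"
    if "x \<in> \<Omega>" for x
    using that p q unfolding C11_bounded_def P_def Q_def by (auto intro: differentiable_imp_GDERIV_grad)
  obtain KP KQ where KP: "KP-lipschitz_on \<Omega> P" and KQ: "KQ-lipschitz_on \<Omega> Q"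
    using p q unfolding C11_bounded_def P_def Q_def by blast
  obtain ZP ZQ where ZP: "negligible ZP" "\<And>x. x \<in> \<Omega> - ZP \<Longrightarrow> \<exists>H. (P has_derivative H) (at x) \<and> onorm H \<le> C"
    and ZQ: "negligible ZQ" "\<And>x. x \<in> \<Omega> - ZQ \<Longrightarrow> \<exists>H. (Q has_derivative H) (at x) \<and> onorm H \<le> B"
    using p q unfolding C11_bounded_def P_def Q_def by metis
  have derw: "GDERIV w x :> W x" if "x \<in> \<Omega>" for x
    unfolding w_def W_def using derp derq that by (intro GDERIV_diff) auto
  have derr: "GDERIV r x :> R x" if "x \<in> \<Omega>" for x
    unfolding r_def R_def s_def w_def[symmetric]
    using derp derw that h(1) by (intro GDERIV_diff GDERIV_DERIV_compose) auto
  then have grad_r: "grad r x = R x" if "x \<in> \<Omega>" for x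
    using that GDERIV_imp_grad by blast
  have normW: "norm (W x) \<le> 2 * L" if "x \<in> \<Omega>" for x
    using norm_triangle_ineq4[of "P x" "Q x"] bd[OF that] by (simp add: W_def)
  have R_alt: "R x = (1 - s x) *\<^sub>R P x + s x *\<^sub>R Q x" for x
    by (simp add: R_def W_def algebra_simps)
  have "norm (R x) \<le> L" if "x \<in> \<Omega>" for x
  proof -
    have "norm (R x) \<le> (1 - s x) * norm (P x) + s x * norm (Q x)"
      unfolding R_alt using s01[of x] norm_triangle_ineq[of "(1 - s x) *\<^sub>R P x" "s x *\<^sub>R Q x"] by simp
    also have "\<dots> \<le> (1 - s x) * L + s x * L"
      using s01 bd[OF that] by (intro add_mono mult_left_mono) auto
    finally show ?thesis by (simp add: algebra_simps)
  qed
  moreover have "r differentiable (at x)" if "x \<in> \<Omega>" for x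
    using derr[OF that] by (auto simp: gderiv_def differentiable_def)
  moreover
  have w_lip: "(2 * L)-lipschitz_on \<Omega> w"
  proof (rule bounded_derivative_imp_lipschitz[OF _ \<Omega>(2)])
    fix x assume x: "x \<in> \<Omega>"
    show "(w has_derivative (\<lambda>h. h \<bullet> W x)) (at x within \<Omega>)"
      using derw[OF x] by (auto simp: gderiv_def intro: has_derivative_at_withinI)
    show "onorm (\<lambda>h. h \<bullet> W x) \<le> 2 * L"
      using normW[OF x] by (intro onorm_le) (smt (verit) Cauchy_Schwarz_ineq2 mult.commute mult_right_mono norm_ge_zero real_norm_def)
  qed (use \<open>0 \<le> L\<close> in auto)
  have s_lip: "(K * (2 * L))-lipschitz_on \<Omega> s"
    unfolding s_def using lipschitz_on_compose2[OF w_lip, of K h'] h(3) lipschitz_on_subset by blast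
  have W_lip: "(KP + KQ)-lipschitz_on \<Omega> W"
    unfolding W_def by (intro lipschitz_on_diff KP KQ)
  have "\<exists>K. K-lipschitz_on \<Omega> R"
    unfolding R_def
    using lipschitz_on_diff[OF KP lipschitz_on_scaleR_bounded[OF s_lip _ W_lip normW, of 1]] s01 \<open>0 \<le> L\<close>
    by fastforce
  then have "\<exists>K. K-lipschitz_on \<Omega> (grad r)"
    using grad_r lipschitz_on_transform by metis
  moreover
  define Z where "Z = ZP \<union> ZQ \<union> {x \<in> \<Omega>. W x \<noteq> 0 \<and> w x \<in> N}"
  have "negligible Z"
    unfolding Z_def by (intro negligible_Un ZP ZQ negligible_vimage_grad_nonzero N derw)
  moreover have "\<exists>H. (grad r has_derivative H) (at x) \<and> onorm H \<le> B + 4 * L\<^sup>2 * M" if x: "x \<in> \<Omega> - Z" for x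
  proof -
    obtain HP HQ where HP: "(P has_derivative HP) (at x)" "onorm HP \<le> C"
      and HQ: "(Q has_derivative HQ) (at x)" "onorm HQ \<le> B"
      using ZP(2)[of x] ZQ(2)[of x] x by (auto simp: Z_def)
    define HW where "HW v = HP v - HQ v" for v
    have HW: "(W has_derivative HW) (at x)"
      unfolding W_def HW_def by (intro has_derivative_diff HP HQ)
    \<comment> \<open>The existential \<open>d\<close> covers both cases with one formula: it is the
      derivative of \<open>h'\<close> at \<open>w x\<close> if \<open>W x\<close> is nonzero, and if
      \<open>W x = 0\<close> the rank-one term vanishes and \<open>0\<close> serves.\<close>
    have "\<exists>d. \<bar>d\<bar> \<le> M \<and> ((\<lambda>x. s x *\<^sub>R W x) has_derivative (\<lambda>v. s x *\<^sub>R HW v + (d * (v \<bullet> W x)) *\<^sub>R W x)) (at x)"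
    proof (cases "W x = 0")
      case True
      with has_derivative_scaleR_at_zero[OF \<Omega>(1) _ s_lip W_lip True HW] x \<open>0 \<le> M\<close> show ?thesis
        by (intro exI[of _ 0]) auto
    next
      case False
      then have "w x \<notin> N" using x by (auto simp: Z_def)
      then obtain d where d: "(h' has_real_derivative d) (at (w x))" "\<bar>d\<bar> \<le> M" using N(2) by blast
      have "(s has_derivative (\<lambda>v. d * (v \<bullet> W x))) (at x)"
        unfolding s_def
        using has_derivative_compose[OF derw[unfolded gderiv_def] d(1)[unfolded has_field_derivative_def]] x by auto
      from has_derivative_scaleR[OF this HW] d(2) show ?thesis by blast
    qed
    then obtain d where d: "\<bar>d\<bar> \<le> M"
      "((\<lambda>x. s x *\<^sub>R W x) has_derivative (\<lambda>v. s x *\<^sub>R HW v + (d * (v \<bullet> W x)) *\<^sub>R W x)) (at x)" by blast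
    define H where "H v = HP v - (s x *\<^sub>R HW v + (d * (v \<bullet> W x)) *\<^sub>R W x)" for v
    have "(R has_derivative H) (at x)"
      unfolding R_def H_def by (intro has_derivative_diff HP d)
    then have "(grad r has_derivative H) (at x)"
      using x grad_r by (auto intro: has_derivative_transform_within_open[OF _ \<Omega>(1)])
    moreover have "onorm H \<le> B + 4 * L\<^sup>2 * M"
    proof (rule onorm_le)
      fix v
      have "norm (HP v) \<le> onorm HP * norm v" "norm (HQ v) \<le> onorm HQ * norm v"
        using HP HQ by (auto intro!: onorm dest: has_derivative_bounded_linear)
      moreover have "onorm HP * norm v \<le> B * norm v" "onorm HQ * norm v \<le> B * norm v"
        using HP HQ \<open>C \<le> B\<close> by (auto intro!: mult_right_mono)
      ultimately have HB: "norm (HP v) \<le> B * norm v" "norm (HQ v) \<le> B * norm v" by linarith+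
      \<comment> \<open>Grouping the Hessians into a convex combination before estimating avoids an
        extra factor in front of \<open>B\<close>.\<close>
      have "H v = ((1 - s x) *\<^sub>R HP v + s x *\<^sub>R HQ v) - (d * (v \<bullet> W x)) *\<^sub>R W x"
        by (simp add: H_def HW_def algebra_simps)
      also have "norm \<dots> \<le> norm ((1 - s x) *\<^sub>R HP v + s x *\<^sub>R HQ v) + norm ((d * (v \<bullet> W x)) *\<^sub>R W x)"
        by (rule norm_triangle_ineq4)
      also have "norm ((1 - s x) *\<^sub>R HP v + s x *\<^sub>R HQ v) \<le> (1 - s x) * norm (HP v) + s x * norm (HQ v)"
        using s01[of x] norm_triangle_ineq[of "(1 - s x) *\<^sub>R HP v" "s x *\<^sub>R HQ v"] by simp
      also have "\<dots> \<le> (1 - s x) * (B * norm v) + s x * (B * norm v)"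
        using s01 HB by (intro add_mono mult_left_mono) auto
      also have "\<dots> = B * norm v" by (simp add: algebra_simps)
      also have "norm ((d * (v \<bullet> W x)) *\<^sub>R W x) \<le> (M * (norm v * (2 * L))) * (2 * L)"
      proof -
        have "\<bar>v \<bullet> W x\<bar> \<le> norm v * (2 * L)"
          using Cauchy_Schwarz_ineq2[of v "W x"] mult_left_mono[OF normW, of x "norm v"] x by force
        then show ?thesis
          unfolding norm_scaleR real_norm_def abs_mult
          using d(1) normW[of x] x \<open>0 \<le> L\<close> \<open>0 \<le> M\<close> by (intro mult_mono) auto
      qed
      finally show "norm (H v) \<le> (B + 4 * L\<^sup>2 * M) * norm v"
        by (simp add: algebra_simps power2_eq_square)
    qed
    ultimately show ?thesis by blast
  qed
  ultimately show ?thesis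
    unfolding C11_bounded_def r_def[symmetric] using grad_r by (metis (no_types, lifting))
qed

section \<open>Operator norm and measurability of the Hessian\<close>

lemma opnorm_diff_le: "\<bar>opnorm A - opnorm B\<bar> \<le> opnorm (A - B)"
proof -
  have *: "opnorm A \<le> opnorm B + opnorm (A - B)" for A B :: "real^'d^'d"
    using onorm_triangle[of "\<lambda>h. B *v h" "\<lambda>h. (A - B) *v h"]
    by (simp add: opnorm_def flip: matrix_vector_mult_add_rdistrib)
  have "opnorm (B - A) = opnorm (A - B)"
    unfolding opnorm_def
    by (simp add: matrix_vector_mult_diff_rdistrib norm_minus_commute onorm_def)
  then show ?thesis using *[of A B] *[of B A] by linarith
qed

text \<open>Topology and measurability on matrices refer to the Frobenius norm. Every entry is
  bounded by that norm, which gives a crude dimensional Lipschitz constant for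
  \<open>opnorm\<close>.\<close>

lemma continuous_on_opnorm: "continuous_on S (opnorm :: real^'d^'d \<Rightarrow> real)"
proof -
  have "opnorm A \<le> real CARD('d) * real CARD('d) * norm A" for A :: "real^'d^'d"
    unfolding opnorm_def
    by (rule onorm_le_matrix_component, rule order_trans[OF component_le_norm_cart Finite_Cartesian_Product.norm_nth_le])
  then have "(real CARD('d) * real CARD('d))-lipschitz_on UNIV (opnorm :: real^'d^'d \<Rightarrow> real)"
    using opnorm_diff_le order_trans by (intro lipschitz_onI) (auto simp: dist_norm intro: order_trans)
  then show ?thesis
    using lipschitz_on_continuous_on continuous_on_subset by blast
qed

lemma opnorm_hess:
  assumes "(grad f has_derivative H) (at x)"
  shows "opnorm (hess f x) = onorm H"
proof -
  have "(grad f has_derivative (\<lambda>h. hess f x *v h)) (at x)"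
    using assms jacobian_works[of "grad f" "at x"] by (auto simp: hess_def differentiable_def)
  then have "(\<lambda>h. hess f x *v h) = H"
    using assms has_derivative_unique by blast
  then show ?thesis by (simp add: opnorm_def)
qed

text \<open>A derivative is a pointwise limit of difference quotients along the coordinate axes.\<close>

lemma measurable_opnorm_jacobian:
  fixes F :: "real^'d \<Rightarrow> real^'d"
  assumes "open \<Omega>" "continuous_on \<Omega> F" "negligible Z"
    and diff: "\<And>x. x \<in> \<Omega> - Z \<Longrightarrow> F differentiable (at x)"
  shows "(\<lambda>x. opnorm (jacobian F (at x))) \<in> borel_measurable (lebesgue_on \<Omega>)"
proof -
  \<comment> \<open>Extension by zero gives a Borel function on the whole space, so the quotients
    remain measurable although the shifted point may leave \<open>\<Omega>\<close>.\<close>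
  define G where "G x = indicator \<Omega> x *\<^sub>R F x" for x
  define t where "t k = inverse (real (Suc k))" for k
  define q where "q k x = (\<chi> i j. (G (x + t k *\<^sub>R axis j 1) $ i - G x $ i) / t k)" for k x
  have [measurable]: "G \<in> borel_measurable borel"
    unfolding G_def using assms by (intro borel_measurable_continuous_on_indicator) auto
  have [measurable]: "(\<lambda>x. G (x + c) $ i) \<in> borel_measurable borel" for c i
  proof -
    have "(\<lambda>x. G (x + c) \<bullet> axis i 1) \<in> borel_measurable borel" by measurable
    then show ?thesis by (simp add: inner_axis)
  qed
  have [measurable]: "(\<lambda>x. G x $ i) \<in> borel_measurable borel" for i
    using \<open>\<And>c i. (\<lambda>x. G (x + c) $ i) \<in> borel_measurable borel\<close>[of 0 i] by simp
  have "q k \<in> borel_measurable borel" for k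
  proof (subst borel_measurable_euclidean_space, rule ballI)
    fix b :: "real^'d^'d" assume "b \<in> Basis"
    then obtain i j where "b = axis i (axis j 1)" by (auto simp: Basis_vec_def)
    then have "(\<lambda>x. q k x \<bullet> b) = (\<lambda>x. (G (x + t k *\<^sub>R axis j 1) $ i - G x $ i) / t k)"
      by (simp add: q_def inner_axis)
    then show "(\<lambda>x. q k x \<bullet> b) \<in> borel_measurable borel" by simp
  qed
  then have "(\<lambda>x. opnorm (q k x)) \<in> borel_measurable borel" for k
    by (rule measurable_compose) (auto intro: borel_measurable_continuous_onI continuous_on_opnorm)
  then have [measurable]: "(\<lambda>x. opnorm (q k x)) \<in> borel_measurable lebesgue" for k
    by (simp add: measurable_completion)
  have [measurable]: "\<Omega> \<in> sets lebesgue" "\<Omega> - Z \<in> sets lebesgue"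
    using assms by (auto simp: lmeasurable_open negligible_imp_sets)
  have t: "filterlim t (at 0) sequentially"
    unfolding t_def by (rule filterlim_atI[OF LIMSEQ_inverse_real_of_nat]) auto
  have lim: "(\<lambda>k. q k x) \<longlonglongrightarrow> jacobian F (at x)" if x: "x \<in> \<Omega> - Z" for x
  proof -
    let ?J = "jacobian F (at x)"
    have "(F has_derivative (\<lambda>h. ?J *v h)) (at x)"
      using diff[OF x] jacobian_works by blast
    then have G: "(G has_derivative (\<lambda>h. ?J *v h)) (at x)"
      by (rule has_derivative_transform_within_open[OF _ \<open>open \<Omega>\<close>]) (use x in \<open>auto simp: G_def\<close>)
    have "(\<lambda>k. (G (x + t k *\<^sub>R axis j 1) $ i - G x $ i) / t k) \<longlonglongrightarrow> ?J $ i $ j" for i j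
    proof -
      have "((\<lambda>s. x + s *\<^sub>R axis j 1) has_derivative (\<lambda>s. s *\<^sub>R axis j 1)) (at 0)"
        by (auto intro!: derivative_eq_intros)
      then have "((\<lambda>s. G (x + s *\<^sub>R axis j 1)) has_derivative (\<lambda>s. ?J *v (s *\<^sub>R axis j 1))) (at 0)"
        by (rule has_derivative_compose) (use G in simp)
      from bounded_linear.has_derivative[OF bounded_linear_vec_nth this]
      have "((\<lambda>s. G (x + s *\<^sub>R axis j 1) $ i) has_real_derivative ?J $ i $ j) (at 0)"
        unfolding has_field_derivative_def
        by (rule has_derivative_eq_rhs)
          (auto simp: fun_eq_iff matrix_vector_mult_scaleR matrix_vector_mul_component inner_axis)
      then have "((\<lambda>s. (G (x + s *\<^sub>R axis j 1) $ i - G x $ i) / s) \<longlongrightarrow> ?J $ i $ j) (at 0)"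
        by (simp add: has_field_derivative_iff)
      from filterlim_compose[OF this t] show ?thesis .
    qed
    then show ?thesis
      unfolding q_def by (intro vec_tendstoI) auto
  qed
  \<comment> \<open>On \<open>Z\<close> the quotients need not converge. The indicator restores
    convergence everywhere, and the values on the null set are put back afterwards by completeness
    of \<open>lebesgue\<close>.\<close>
  have "(\<lambda>x. indicator (\<Omega> - Z) x * opnorm (jacobian F (at x))) \<in> borel_measurable lebesgue"
  proof (rule borel_measurable_LIMSEQ_real)
    show "(\<lambda>k. indicator (\<Omega> - Z) x * opnorm (q k x)) \<longlonglongrightarrow> indicator (\<Omega> - Z) x * opnorm (jacobian F (at x))" for x
    proof (cases "x \<in> \<Omega> - Z")
      case True
      have "isCont opnorm (jacobian F (at x))"
        using continuous_on_opnorm[where S = "UNIV :: (real^'d^'d) set"] by (simp add: continuous_on_eq_continuous_at)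
      from isCont_tendsto_compose[OF this lim[OF True]] show ?thesis by (intro tendsto_intros)
    qed auto
  qed measurable
  moreover have "AE x in lebesgue. indicator (\<Omega> - Z) x * opnorm (jacobian F (at x))
      = (if x \<in> \<Omega> then opnorm (jacobian F (at x)) else 0)"
    unfolding eventually_ae_filter_negligible
    using assms by (intro exI[of _ Z]) (auto simp: indicator_def)
  ultimately have "(\<lambda>x. if x \<in> \<Omega> then opnorm (jacobian F (at x)) else 0) \<in> borel_measurable lebesgue"
    by (rule borel_measurable_AE)
  then show ?thesis by (rule borel_measurable_if_D)
qed

section \<open>Bounds supplied by the data and by the smoothing family\<close>

text \<open>The closure of a bounded set is compact, so the set under \<open>Sup\<close> is bounded
  above and the supremum really dominates its elements. \<open>N\<close> is applied both as the
  Euclidean norm and as \<open>opnorm\<close>.\<close>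

lemma sup_norm_cont_ext:
  fixes F :: "'a::euclidean_space \<Rightarrow> 'b::topological_space" and N :: "'b \<Rightarrow> real"
  assumes "\<exists>G. is_cont_ext \<Omega> F G" "bounded \<Omega>" "continuous_on UNIV N"
  shows "0 \<le> sup_norm (closure \<Omega>) (\<lambda>x. N (cont_ext \<Omega> F x))"
    and "\<And>x. x \<in> \<Omega> \<Longrightarrow> N (F x) \<le> sup_norm (closure \<Omega>) (\<lambda>x. N (cont_ext \<Omega> F x))"
proof -
  have ext: "is_cont_ext \<Omega> F (cont_ext \<Omega> F)"
    unfolding cont_ext_def using assms(1) by (rule someI_ex)
  then have "continuous_on (closure \<Omega>) (\<lambda>x. N (cont_ext \<Omega> F x))"
    by (intro continuous_on_compose2[OF assms(3)]) (auto simp: is_cont_ext_def)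
  then have "compact ((\<lambda>x. N (cont_ext \<Omega> F x)) ` closure \<Omega>)"
    using assms(2) by (intro compact_continuous_image) auto
  then have bdd: "bdd_above (insert 0 ((\<lambda>x. N (cont_ext \<Omega> F x)) ` closure \<Omega>))"
    by (simp add: bounded_imp_bdd_above compact_imp_bounded)
  then show "0 \<le> sup_norm (closure \<Omega>) (\<lambda>x. N (cont_ext \<Omega> F x))"
    unfolding sup_norm_def by (rule cSup_upper[rotated]) simp
  fix x assume x: "x \<in> \<Omega>"
  then have "N (F x) = N (cont_ext \<Omega> F x)" using ext by (simp add: is_cont_ext_def)
  then show "N (F x) \<le> sup_norm (closure \<Omega>) (\<lambda>x. N (cont_ext \<Omega> F x))"
    unfolding sup_norm_def using closure_subset[of \<Omega>] x by (intro cSup_upper[OF _ bdd]) auto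
qed

text \<open>On a convex set, derivative bounds are Lipschitz constants; the one for \<open>f\<close>
  passes to the closure by continuity. The exceptional set in \<open>C11_bounded\<close> is empty
  here.\<close>

lemma C2_closure_bounds:
  fixes f :: "real^'d \<Rightarrow> real"
  assumes f: "C2_closure \<Omega> f" and \<Omega>: "bounded \<Omega>" "convex \<Omega>"
    and L: "sup_norm (closure \<Omega>) (\<lambda>x. norm (cont_ext \<Omega> (grad f) x)) \<le> L"
    and C: "sup_norm (closure \<Omega>) (\<lambda>x. opnorm (cont_ext \<Omega> (hess f) x)) \<le> C"
  shows "0 \<le> L" "0 \<le> C" "C-lipschitz_on \<Omega> (grad f)" "L-lipschitz_on (closure \<Omega>) f"
    and "C11_bounded \<Omega> L C f"
proof -
  have ext: "\<exists>G. is_cont_ext \<Omega> (grad f) G" "\<exists>H. is_cont_ext \<Omega> (hess f) H"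
    using f by (auto simp: C2_closure_def)
  note grad_sup = sup_norm_cont_ext[where N = norm, OF ext(1) \<Omega>(1) continuous_on_norm_id]
  note hess_sup = sup_norm_cont_ext[where N = opnorm, OF ext(2) \<Omega>(1) continuous_on_opnorm]
  show L0: "0 \<le> L" and C0: "0 \<le> C" using grad_sup(1) hess_sup(1) L C by linarith+
  have grad_le: "norm (grad f x) \<le> L" and hess_le: "opnorm (hess f x) \<le> C" if "x \<in> \<Omega>" for x
    using grad_sup(2)[OF that] hess_sup(2)[OF that] L C by linarith+
  have der: "(f has_derivative (\<lambda>h. h \<bullet> grad f x)) (at x)"
    and hess: "(grad f has_derivative (\<lambda>h. hess f x *v h)) (at x)" if "x \<in> \<Omega>" for x
    using that f differentiable_imp_GDERIV_grad[of f x] jacobian_works[of "grad f" "at x"]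
    by (auto simp: C2_closure_def gderiv_def hess_def)
  show lip: "C-lipschitz_on \<Omega> (grad f)"
    using hess hess_le C0 \<Omega>(2) unfolding opnorm_def
    by (intro bounded_derivative_imp_lipschitz) (auto intro: has_derivative_at_withinI)
  have "L-lipschitz_on \<Omega> f"
  proof (rule bounded_derivative_imp_lipschitz[OF _ \<Omega>(2) _ L0])
    fix x assume x: "x \<in> \<Omega>"
    show "(f has_derivative (\<lambda>h. h \<bullet> grad f x)) (at x within \<Omega>)"
      using der[OF x] by (rule has_derivative_at_withinI)
    have "norm (h \<bullet> grad f x) \<le> L * norm h" for h
      using Cauchy_Schwarz_ineq2[of h "grad f x"] mult_left_mono[OF grad_le[OF x], of "norm h"]
      by (simp add: mult.commute)
    then show "onorm (\<lambda>h. h \<bullet> grad f x) \<le> L" by (rule onorm_le)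
  qed
  then show "L-lipschitz_on (closure \<Omega>) f"
    using f by (intro lipschitz_on_closure) (auto simp: C2_closure_def)
  show "C11_bounded \<Omega> L C f"
    unfolding C11_bounded_def
    using f lip grad_le hess hess_le
    by (intro conjI exI[of _ "{}"]) (auto simp: C2_closure_def opnorm_def)
qed

text \<open>The essential supremum is itself an almost everywhere bound. Its nonnegativity requires
  a point at which the bound holds, and one exists because Lebesgue measure is not zero.\<close>

lemma Linf_norm_finite_nonneg:
  fixes f :: "'a::euclidean_space \<Rightarrow> real"
  assumes fin: "Linf_norm UNIV f < \<infinity>" and nonneg: "\<And>x. 0 \<le> f x"
  obtains M where "Linf_norm UNIV f = ereal M" "0 \<le> M" "AE x in lebesgue. f x \<le> M"
proof -
  have AE: "AE x in lebesgue. ereal (f x) \<le> Linf_norm UNIV f"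
    using esssup_AE[of "\<lambda>x. ereal (f x)" lebesgue] by (simp add: Linf_norm_def lebesgue_on_UNIV_eq)
  then obtain x where "ereal (f x) \<le> Linf_norm UNIV f"
    using eventually_happens[OF AE] by (auto simp: ae_filter_eq_bot_iff)
  then have "0 \<le> Linf_norm UNIV f"
    using nonneg[of x] order_trans[of 0 "ereal (f x)"] by simp
  with fin obtain M where "Linf_norm UNIV f = ereal M" "0 \<le> M"
    by (cases "Linf_norm UNIV f") auto
  with AE that show ?thesis by simp
qed

lemma admissible_smoothing_familyD:
  assumes "admissible_smoothing_family g" and "\<epsilon> > 0"
  shows "(g \<epsilon> has_real_derivative deriv (g \<epsilon>) y) (at y)" "deriv (g \<epsilon>) y \<in> {0..1}"
    and "\<exists>K. K-lipschitz_on UNIV (deriv (g \<epsilon>))"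
    and "\<bar>max x 0 - g \<epsilon> x\<bar> \<le> \<epsilon>"
    and "AE x in lebesgue. deriv (g \<epsilon>) differentiable (at x) \<and> 0 \<le> deriv (deriv (g \<epsilon>)) x"
    and "Linf_norm UNIV (\<lambda>x. \<bar>deriv (deriv (g \<epsilon>)) x\<bar>) < \<infinity>"
proof -
  note g = assms(1)[unfolded admissible_smoothing_family_def, THEN conjunct1, rule_format, OF assms(2)]
  from g have "C11_on UNIV (g \<epsilon>)" by (rule conjunct1)
  then show "(g \<epsilon> has_real_derivative deriv (g \<epsilon>) y) (at y)"
    and "\<exists>K. K-lipschitz_on UNIV (deriv (g \<epsilon>))"
    unfolding C11_on_def grad_real by (simp_all add: DERIV_deriv_iff_real_differentiable)
  show "deriv (g \<epsilon>) y \<in> {0..1}"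
    using g[THEN conjunct2, THEN conjunct1] by blast
  show "\<bar>max x 0 - g \<epsilon> x\<bar> \<le> \<epsilon>"
    using g[THEN conjunct2, THEN conjunct2, THEN conjunct2, THEN conjunct1] by blast
  show "AE x in lebesgue. deriv (g \<epsilon>) differentiable (at x) \<and> 0 \<le> deriv (deriv (g \<epsilon>)) x"
    using g[THEN conjunct2, THEN conjunct2, THEN conjunct1] .
  show "Linf_norm UNIV (\<lambda>x. \<bar>deriv (deriv (g \<epsilon>)) x\<bar>) < \<infinity>"
    using g[THEN conjunct2, THEN conjunct2, THEN conjunct2, THEN conjunct2] .
qed

text \<open>Both \<open>h\<close> and the identity minus \<open>h\<close> have nonnegative
  derivative.\<close>

lemma deriv_unit_interval_imp_mono:
  fixes h :: "real \<Rightarrow> real"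
  assumes h: "\<And>y. (h has_real_derivative h' y) (at y)" "\<And>y. h' y \<in> {0..1}" and "x \<le> y"
  shows "h x \<le> h y \<and> h y - h x \<le> y - x"
proof
  have "\<exists>d. (h has_real_derivative d) (at t) \<and> 0 \<le> d" for t
    using h(1)[of t] h(2)[of t] by (intro exI[of _ "h' t"]) simp
  then show "h x \<le> h y"
    by (rule DERIV_nonneg_imp_nondecreasing[OF \<open>x \<le> y\<close>])
  have "\<exists>d. ((\<lambda>x. x - h x) has_real_derivative d) (at t) \<and> 0 \<le> d" for t
    using DERIV_diff[OF DERIV_ident h(1)[of t]] h(2)[of t] by (intro exI[of _ "1 - h' t"]) simp
  then have "x - h x \<le> y - h y"
    by (rule DERIV_nonneg_imp_nondecreasing[OF \<open>x \<le> y\<close>])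
  then show "h y - h x \<le> y - x" by simp
qed

lemma admissible_smoothing_convex:
  assumes "admissible_smoothing_family g" "\<epsilon> > 0"
  shows "convex_on UNIV (g \<epsilon>)"
proof -
  note h = admissible_smoothing_familyD[OF assms]
  obtain K where K: "K-lipschitz_on UNIV (deriv (g \<epsilon>))" using h(3) by blast
  obtain E where E: "negligible E"
    "\<And>x. x \<notin> E \<Longrightarrow> deriv (g \<epsilon>) differentiable (at x) \<and> 0 \<le> deriv (deriv (g \<epsilon>)) x"
    using h(5) unfolding eventually_ae_filter_negligible by blast
  have "mono (deriv (g \<epsilon>))"
    using E by (intro ae_deriv_nonneg_imp_mono[OF K E(1), of "deriv (deriv (g \<epsilon>))"]) (auto simp: DERIV_deriv_iff_real_differentiable)
  then show ?thesis
    by (intro convex_on_realI[where f' = "deriv (g \<epsilon>)"] h(1)) (auto dest: monoD)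
qed

section \<open>Induction on the number of functions and conclusion\<close>

text \<open>The bound of the partial minimum starts at \<open>C\<close> and only grows, so it
  dominates the constant \<open>C\<close> of the next function, as the single step demands.\<close>

lemma C11_bounded_psi_smooth:
  assumes \<Omega>: "open \<Omega>" "convex \<Omega>" and n: "1 \<le> n"
    and f: "\<And>i. i \<in> {1..n} \<Longrightarrow> C11_bounded \<Omega> L C (f i)" and "0 \<le> L"
    and h: "\<And>y. (h has_real_derivative h' y) (at y)" "\<And>y. h' y \<in> {0..1}" "K-lipschitz_on UNIV h'"
    and N: "negligible N" "\<And>y. y \<notin> N \<Longrightarrow> \<exists>d. (h' has_real_derivative d) (at y) \<and> \<bar>d\<bar> \<le> M" and "0 \<le> M"
  shows "C11_bounded \<Omega> L (C + (real n - 1) * (4 * L\<^sup>2 * M)) (\<lambda>x. psi_smooth h n (\<lambda>i. f i x))"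
  using n f
proof (induction n rule: nat_induct_at_least)
  case (Suc n)
  then have IH: "C11_bounded \<Omega> L (C + (real n - 1) * (4 * L\<^sup>2 * M)) (\<lambda>x. psi_smooth h n (\<lambda>i. f i x))"
    and fn: "C11_bounded \<Omega> L C (f (Suc n))" by auto
  have "C \<le> C + (real n - 1) * (4 * L\<^sup>2 * M)" using Suc.hyps \<open>0 \<le> M\<close> by simp
  from C11_bounded_smoothed_min[OF \<Omega> fn IH this \<open>0 \<le> L\<close> h N \<open>0 \<le> M\<close>] show ?case
    using Suc.hyps by (simp add: psi_smooth_Suc algebra_simps)
qed simp

theorem proposition2p3:
  fixes \<Omega> :: "(real^'d) set"
    and n :: nat
    and \<phi> :: "nat \<Rightarrow> real^'d \<Rightarrow> real"
    and g :: "real \<Rightarrow> real \<Rightarrow> real"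
    and \<epsilon> C L :: real
    and v v\<^sub>\<epsilon> :: "real^'d \<Rightarrow> real"
  assumes "open \<Omega>" and "bounded \<Omega>" and "convex \<Omega>"
    and "n \<ge> 1"
    and "\<And>i. i \<in> {1..n} \<Longrightarrow> C2_closure \<Omega> (\<phi> i)"
    and "admissible_smoothing_family g"
    and "\<epsilon> > 0"
    and v_def: "v = (\<lambda>x. psi n (\<lambda>i. \<phi> i x))"
    and v\<epsilon>_def: "v\<^sub>\<epsilon> = (\<lambda>x. psi_smooth (g \<epsilon>) n (\<lambda>i. \<phi> i x))"
    and C_def: "C = Max ((\<lambda>i. sup_norm (closure \<Omega>) (\<lambda>x. opnorm (cont_ext \<Omega> (hess (\<phi> i)) x))) ` {1..n})"
    and L_def: "L = Max ((\<lambda>i. sup_norm (closure \<Omega>) (\<lambda>x. norm (cont_ext \<Omega> (grad (\<phi> i)) x))) ` {1..n})"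
  shows "semiconcave \<Omega> C v\<^sub>\<epsilon>
    \<and> L-lipschitz_on (closure \<Omega>) v\<^sub>\<epsilon>
    \<and> sup_norm (closure \<Omega>) (\<lambda>x. \<bar>v\<^sub>\<epsilon> x - v x\<bar>) \<le> (real n - 1) * \<epsilon>
    \<and> C11_on \<Omega> v\<^sub>\<epsilon>
    \<and> (AE x in lebesgue_on \<Omega>. grad v\<^sub>\<epsilon> differentiable (at x))
    \<and> Linf_norm \<Omega> (\<lambda>x. opnorm (hess v\<^sub>\<epsilon> x))
        \<le> ereal C + ereal (2 * real n * (real n - 1) * L\<^sup>2)
            * Linf_norm UNIV (\<lambda>x. \<bar>deriv (deriv (g \<epsilon>)) x\<bar>)"
proof -
  note \<Omega> = assms(1-3) and n = assms(4) and \<phi> = assms(5) and \<epsilon> = assms(7)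
  note g = admissible_smoothing_familyD[OF assms(6) \<epsilon>]
  note mono = deriv_unit_interval_imp_mono[OF g(1,2)]
  note convex = admissible_smoothing_convex[OF assms(6) \<epsilon>]
  obtain K where K: "K-lipschitz_on UNIV (deriv (g \<epsilon>))" using g(3) by blast
  obtain M where M: "Linf_norm UNIV (\<lambda>x. \<bar>deriv (deriv (g \<epsilon>)) x\<bar>) = ereal M" "0 \<le> M"
    "AE x in lebesgue. \<bar>deriv (deriv (g \<epsilon>)) x\<bar> \<le> M"
    using Linf_norm_finite_nonneg[OF g(6)] by auto
  \<comment> \<open>One null set \<open>N\<close> collects the points without a second derivative
    and those where it exceeds its essential bound.\<close>
  have "AE x in lebesgue. deriv (g \<epsilon>) differentiable (at x) \<and> \<bar>deriv (deriv (g \<epsilon>)) x\<bar> \<le> M"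
    using g(5) M(3) by eventually_elim auto
  then obtain N where N: "negligible N"
    "\<And>x. x \<notin> N \<Longrightarrow> deriv (g \<epsilon>) differentiable (at x) \<and> \<bar>deriv (deriv (g \<epsilon>)) x\<bar> \<le> M"
    unfolding eventually_ae_filter_negligible by blast
  have N_der: "\<exists>d. (deriv (g \<epsilon>) has_real_derivative d) (at y) \<and> \<bar>d\<bar> \<le> M" if "y \<notin> N" for y
    using N(2)[OF that] DERIV_deriv_iff_real_differentiable by blast
  have "sup_norm (closure \<Omega>) (\<lambda>x. norm (cont_ext \<Omega> (grad (\<phi> i)) x)) \<le> L"
    "sup_norm (closure \<Omega>) (\<lambda>x. opnorm (cont_ext \<Omega> (hess (\<phi> i)) x)) \<le> C" if "i \<in> {1..n}" for i
    using that unfolding L_def C_def by (auto intro!: Max_ge)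
  then have bounds: "0 \<le> L" "0 \<le> C" "C-lipschitz_on \<Omega> (grad (\<phi> i))"
    "L-lipschitz_on (closure \<Omega>) (\<phi> i)" "C11_bounded \<Omega> L C (\<phi> i)" if "i \<in> {1..n}" for i
    using that C2_closure_bounds[OF \<phi> \<Omega>(2,3)] by blast+
  have L0: "0 \<le> L" and C0: "0 \<le> C" using bounds(1,2)[of 1] n by auto
  define B where "B = C + (real n - 1) * (4 * L\<^sup>2 * M)"
  have v: "C11_bounded \<Omega> L B v\<^sub>\<epsilon>"
    unfolding v\<epsilon>_def B_def
    by (rule C11_bounded_psi_smooth[OF \<Omega>(1,3) n bounds(5) L0 g(1,2) K N(1) N_der M(2)])
  then obtain Z where Z: "negligible Z"
    "\<And>x. x \<in> \<Omega> - Z \<Longrightarrow> \<exists>H. (grad v\<^sub>\<epsilon> has_derivative H) (at x) \<and> onorm H \<le> B"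
    unfolding C11_bounded_def by metis
  have v_lip: "L-lipschitz_on (closure \<Omega>) v\<^sub>\<epsilon>"
    unfolding v\<epsilon>_def by (rule lipschitz_on_psi_smooth[OF mono n bounds(4)])
  have "semiconcave \<Omega> C v\<^sub>\<epsilon>"
    unfolding semiconcave_def
  proof (intro conjI C0)
    show "continuous_on (closure \<Omega>) v\<^sub>\<epsilon>" using v_lip by (rule lipschitz_on_continuous_on)
    have conc: "concave_on \<Omega> (\<lambda>x. \<phi> i x - C / 2 * (norm x)\<^sup>2)" if i: "i \<in> {1..n}" for i
    proof (rule lipschitz_grad_imp_concave_on[OF \<Omega>(3)])
      show "C-lipschitz_on \<Omega> (grad (\<phi> i))" using bounds(3) i by blast
      show "GDERIV (\<phi> i) x :> grad (\<phi> i) x" if "x \<in> \<Omega>" for x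
        using \<phi>[OF i] that by (auto simp: C2_closure_def intro: differentiable_imp_GDERIV_grad)
    qed
    show "concave_on \<Omega> (\<lambda>x. v\<^sub>\<epsilon> x - C / 2 * (norm x)\<^sup>2)"
      unfolding v\<epsilon>_def by (rule concave_on_psi_smooth[OF mono convex n conc])
  qed
  moreover have "sup_norm (closure \<Omega>) (\<lambda>x. \<bar>v\<^sub>\<epsilon> x - v x\<bar>) \<le> (real n - 1) * \<epsilon>"
    unfolding sup_norm_def
  \<comment> \<open>The inserted \<open>0\<close> must obey the bound as well, which uses
    \<open>n \<ge> 1\<close> and \<open>\<epsilon> > 0\<close>.\<close>
  proof (rule cSup_least)
    have "\<bar>v\<^sub>\<epsilon> x - v x\<bar> \<le> (real n - 1) * \<epsilon>" for x
      unfolding v_def v\<epsilon>_def by (rule psi_smooth_error[OF g(4) n])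
    then show "y \<le> (real n - 1) * \<epsilon>" if "y \<in> insert 0 ((\<lambda>x. \<bar>v\<^sub>\<epsilon> x - v x\<bar>) ` closure \<Omega>)" for y
      using that n \<epsilon> by auto
  qed simp
  moreover have C11: "C11_on \<Omega> v\<^sub>\<epsilon>"
    using v by (auto simp: C11_bounded_def C11_on_def)
  have \<Omega>_sets: "\<Omega> \<inter> space lebesgue \<in> sets lebesgue" using \<Omega>(1) by auto
  have AE: "AE x in lebesgue_on \<Omega>. P x" if "\<And>x. x \<in> \<Omega> - Z \<Longrightarrow> P x" for P
    unfolding AE_restrict_space_iff[OF \<Omega>_sets] eventually_ae_filter_negligible
    using that Z(1) by blast
  have diff: "grad v\<^sub>\<epsilon> differentiable (at x)" if "x \<in> \<Omega> - Z" for x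
    using Z(2)[OF that] by (auto simp: differentiable_def)
  moreover have "Linf_norm \<Omega> (\<lambda>x. opnorm (hess v\<^sub>\<epsilon> x))
      \<le> ereal C + ereal (2 * real n * (real n - 1) * L\<^sup>2) * ereal M"
  proof -
    have "continuous_on \<Omega> (grad v\<^sub>\<epsilon>)"
      using C11 lipschitz_on_continuous_on by (auto simp: C11_on_def)
    \<comment> \<open>For a nonmeasurable function \<open>esssup\<close> takes the default value
      \<open>top\<close>, so the pointwise bound alone would not suffice.\<close>
    then have "(\<lambda>x. opnorm (hess v\<^sub>\<epsilon> x)) \<in> borel_measurable (lebesgue_on \<Omega>)"
      unfolding hess_def using measurable_opnorm_jacobian[OF \<Omega>(1) _ Z(1) diff] by blast
    moreover have "opnorm (hess v\<^sub>\<epsilon> x) \<le> B" if "x \<in> \<Omega> - Z" for x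
      using Z(2)[OF that] opnorm_hess by metis
    ultimately have "Linf_norm \<Omega> (\<lambda>x. opnorm (hess v\<^sub>\<epsilon> x)) \<le> ereal B"
      unfolding Linf_norm_def by (intro esssup_I AE) auto
    also have "B \<le> C + 2 * real n * (real n - 1) * L\<^sup>2 * M"
    proof -
      \<comment> \<open>For \<open>n = 1\<close> the comparison \<open>4 \<le> 2 * n\<close> fails,
        but then the factor \<open>real n - 1\<close> is zero.\<close>
      have "4 * (real n - 1) \<le> 2 * real n * (real n - 1)"
      proof (cases "n = 1")
        case False
        then show ?thesis using n by (intro mult_right_mono) auto
      qed simp
      moreover have "0 \<le> L\<^sup>2 * M" using M(2) by simp
      ultimately have "4 * (real n - 1) * (L\<^sup>2 * M) \<le> 2 * real n * (real n - 1) * (L\<^sup>2 * M)"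
        by (rule mult_right_mono)
      then show ?thesis unfolding B_def by (simp only: ac_simps add_le_cancel_left)
    qed
    finally show ?thesis by simp
  qed
  moreover have "AE x in lebesgue_on \<Omega>. grad v\<^sub>\<epsilon> differentiable (at x)"
    using diff by (rule AE)
  ultimately show ?thesis
    unfolding M(1) using v_lip C11 by (intro conjI)
qed

end
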